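(* Let $G$ be a simple connected graph with $|E(G)|\ge4$ and let $v\in V(G)$. Let $\bar G$ be obtained from $G$ by attaching three new pendant vertices $a,b,c$ to $v$, let $\widetilde G=\bar G+\{a,b\}$, and let $\widehat G=\bar G+\{a,b\}+\{b,c\}$. Then $\mathscr{K}(\widehat G)>\mathscr{K}(\widetilde G)$.
   Context: For connected $H$ with $m\ge1$ edges and degrees $d_i$, Kemeny's constant is $\mathscr{K}(H)=\sum_j\pi_jm_{ij}$ for the simple random walk on $H$ ($\pi_j=d_j/2m$, $m_{ij}$ expected hitting time of $j$ from $i$, $m_{jj}=0$), equivalently $\frac1{4m}\sum_{i,j}d_id_jr_H(i,j)$ with $r_H$ effective resistance. $H+\{x,y\}$ denotes $H$ with the edge $\{x,y\}$ added. *)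

theory Defs
  imports "HOL-Probability.Probability"
begin

text \<open>A graph is given by a vertex set and a set of edges, each edge being a two-element set
  of vertices; \<open>insert {x, y} E\<close> is the edge set of the graph with the edge \<open>{x, y}\<close> added.\<close>

definition simple_graph :: "'a set \<Rightarrow> 'a set set \<Rightarrow> bool" where
  "simple_graph V E \<longleftrightarrow> finite V \<and> (\<forall>e\<in>E. e \<subseteq> V \<and> card e = 2)"

definition adjacent :: "'a set set \<Rightarrow> 'a \<Rightarrow> 'a \<Rightarrow> bool" where
  "adjacent E x y \<longleftrightarrow> {x, y} \<in> E"

definition connected_graph :: "'a set \<Rightarrow> 'a set set \<Rightarrow> bool" where
  "connected_graph V E \<longleftrightarrow> V \<noteq> {} \<and> (\<forall>x\<in>V. \<forall>y\<in>V. (adjacent E)\<^sup>*\<^sup>* x y)"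

definition vertex_degree :: "'a set set \<Rightarrow> 'a \<Rightarrow> nat" where
  "vertex_degree E x = card {e \<in> E. x \<in> e}"

text \<open>\<open>random_walk E n x\<close> is the law of the trajectory \<open>[X\<^sub>0, \<dots>, X\<^sub>n]\<close> of the simple random
  walk started at \<open>X\<^sub>0 = x\<close>. It is meaningful only if no isolated vertex is reachable from \<open>x\<close>,
  since \<open>pmf_of_set {}\<close> is unspecified.\<close>

primrec random_walk :: "'a set set \<Rightarrow> nat \<Rightarrow> 'a \<Rightarrow> 'a list pmf" where
  "random_walk E 0 x = return_pmf [x]"
| "random_walk E (Suc n) x =
     bind_pmf (pmf_of_set {y. adjacent E x y}) (\<lambda>y. map_pmf ((#) x) (random_walk E n y))"

text \<open>The probability that the walk started at \<open>i\<close> hits \<open>j\<close> for the first time at time \<open>n\<close>.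
  Time \<open>0\<close> counts, so that the mean hitting time of \<open>j\<close> from \<open>j\<close> is \<open>0\<close>.\<close>

definition first_hit_prob :: "'a set set \<Rightarrow> 'a \<Rightarrow> 'a \<Rightarrow> nat \<Rightarrow> real" where
  "first_hit_prob E i j n =
     measure_pmf.prob (random_walk E n i) {w. w ! n = j \<and> (\<forall>k<n. w ! k \<noteq> j)}"

text \<open>On a finite connected graph with at least one edge, the hitting time is almost surely
  finite and the series below converges.\<close>

definition mean_hitting_time :: "'a set set \<Rightarrow> 'a \<Rightarrow> 'a \<Rightarrow> real" where
  "mean_hitting_time E i j = (\<Sum>n. real n * first_hit_prob E i j n)"

definition stationary :: "'a set set \<Rightarrow> 'a \<Rightarrow> real" where
  "stationary E j = real (vertex_degree E j) / (2 * real (card E))"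

text \<open>The sum does not depend on the starting vertex \<open>i\<close> if the graph is finite, connected and
  has an edge; Kemeny's constant is the common value.\<close>

definition kemeny :: "'a set \<Rightarrow> 'a set set \<Rightarrow> real" where
  "kemeny V E = (THE k. \<forall>i\<in>V. (\<Sum>j\<in>V. stationary E j * mean_hitting_time E i j) = k)"

end

theory Submission
  imports Defs
begin

text \<open>Both graphs arise by gluing \<open>G\<close> at \<open>v\<close> to a graph on \<open>{v, a, b, c}\<close>: a triangle with a
  pendant edge, or a complete graph minus an edge. Kemeny's constant may be computed from the
  starting vertex \<open>v\<close>. Gluing \<open>q\<close> edges to a graph with \<open>m\<close> edges at \<open>v\<close> increases the hitting
  time of an old vertex \<open>j\<close> from \<open>v\<close> by \<open>q/m\<close> times the commute time between \<open>v\<close> and \<open>j\<close>, because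
  by Kac's formula the excursions into the new part have a mean length determined by \<open>q\<close>.
  The two Kemeny constants are thereby expressed through \<open>A = \<Sum> deg j * hit v j\<close> and
  \<open>B = \<Sum> deg j * hit j v\<close> on \<open>G\<close>, and up to a positive factor their difference is
  \<open>B + 2/3 m\<^sup>2 - 3/2 m - 23/3\<close>, in which \<open>A\<close> has cancelled. Since \<open>B \<ge> m\<close>, it is positive for
  \<open>m \<ge> 4\<close>.

  The hitting time equations need convergence of the defining series. This comes from bounding the
  truncated means: at neighbours of the target by summing over the stationary distribution, and
  elsewhere by propagation along edges.\<close>

section \<open>Neighbourhoods, reachability and the first-step recursion\<close>

definition neighbours :: "'a set set \<Rightarrow> 'a \<Rightarrow> 'a set" where
  "neighbours E x = {y. adjacent E x y}"

lemma adjacent_sym: "adjacent E x y \<Longrightarrow> adjacent E y x"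
  by (simp add: adjacent_def insert_commute)

lemma reachable_sym: "(adjacent E)\<^sup>*\<^sup>* x y \<Longrightarrow> (adjacent E)\<^sup>*\<^sup>* y x"
  by (induction rule: rtranclp_induct) (auto intro: adjacent_sym converse_rtranclp_into_rtranclp)

lemma reachable_mono: "(adjacent E)\<^sup>*\<^sup>* x y \<Longrightarrow> E \<subseteq> F \<Longrightarrow> (adjacent F)\<^sup>*\<^sup>* x y"
  using rtranclp_mono[of "adjacent E" "adjacent F"] by (auto simp: adjacent_def le_fun_def)

lemma connected_graphI:
  assumes "v \<in> V" "\<And>x. x \<in> V \<Longrightarrow> (adjacent E)\<^sup>*\<^sup>* v x"
  shows "connected_graph V E"
  unfolding connected_graph_def
  using assms(1) rtranclp_trans[OF reachable_sym[OF assms(2)] assms(2)] by auto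

lemma first_hit_prob_0: "first_hit_prob E i j 0 = (if i = j then 1 else 0)"
  by (simp add: first_hit_prob_def)

lemma first_hit_prob_nonneg: "first_hit_prob E i j n \<ge> 0"
  by (simp add: first_hit_prob_def)

text \<open>Conditioning on the first step of the walk. From \<open>i = j\<close> the hit already
  happens at time 0, so no later time can be the first.\<close>

lemma first_hit_prob_Suc:
  assumes "finite (neighbours E i)" "neighbours E i \<noteq> {}"
  shows "first_hit_prob E i j (Suc n) =
    (if i = j then 0
     else (\<Sum>k\<in>neighbours E i. first_hit_prob E k j n) / card (neighbours E i))"
proof -
  let ?A = "{w. w ! Suc n = j \<and> (\<forall>k<Suc n. w ! k \<noteq> j)}"
  let ?B = "{w. w ! n = j \<and> (\<forall>k<n. w ! k \<noteq> j)}"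
  have vimage: "((#) i) -` ?A = (if i = j then {} else ?B)"
    by (auto simp: less_Suc_eq_0_disj)
  have step: "measure_pmf.prob (map_pmf ((#) i) (random_walk E n k)) ?A
      = (if i = j then 0 else first_hit_prob E k j n)" for k
    by (simp only: measure_map_pmf vimage) (simp add: first_hit_prob_def)
  have "first_hit_prob E i j (Suc n) = measure_pmf.expectation (pmf_of_set (neighbours E i))
      (\<lambda>k. measure_pmf.prob (map_pmf ((#) i) (random_walk E n k)) ?A)"
    unfolding first_hit_prob_def random_walk.simps neighbours_def measure_pmf_bind
    by (rule measure_pmf.measure_bind[where N = "count_space UNIV"])
      (auto simp: measurable_def space_subprob_algebra
        measure_pmf.subprob_space_axioms)
  also have "\<dots> = (\<Sum>k\<in>neighbours E i. if i = j then 0 else first_hit_prob E k j n)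
      / card (neighbours E i)"
    using assms by (simp only: step) (simp add: integral_pmf_of_set)
  finally show ?thesis by simp
qed

section \<open>Degrees and double counting in a finite connected graph\<close>

locale walk_graph =
  fixes V :: "'a set" and E :: "'a set set"
  assumes simple: "simple_graph V E" and connected: "connected_graph V E"
    and edges: "E \<noteq> {}"
begin

abbreviation "N \<equiv> neighbours E"
abbreviation "deg x \<equiv> real (card (N x))"
abbreviation "hit \<equiv> mean_hitting_time E"

lemma finite_V: "finite V"
  using simple by (simp add: simple_graph_def)

lemma finite_E: "finite E"
  by (rule finite_subset[of _ "Pow V"]) (use simple in \<open>auto simp: simple_graph_def\<close>)

lemma edge_endpoints: "{x, y} \<in> E \<Longrightarrow> x \<in> V \<and> y \<in> V \<and> x \<noteq> y"
  using simple by (force simp: simple_graph_def card_insert_if)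

lemma neighbours_subset: "N x \<subseteq> V"
  by (auto simp: neighbours_def adjacent_def dest: edge_endpoints)

lemma finite_neighbours: "finite (N x)"
  using finite_subset[OF neighbours_subset finite_V] .

lemma neighbours_sym: "y \<in> N x \<longleftrightarrow> x \<in> N y"
  by (auto simp: neighbours_def intro: adjacent_sym)

lemma card_edges_pos: "card E > 0"
  using edges finite_E by (simp add: card_gt_0_iff)

lemma incident_edges_eq: "{e \<in> E. x \<in> e} = (\<lambda>y. {x, y}) ` N x"
proof (intro equalityI subsetI)
  fix e assume e: "e \<in> {e \<in> E. x \<in> e}"
  then have "card e = 2" using simple by (auto simp: simple_graph_def)
  then obtain y z where "e = {y, z}" by (meson card_2_iff)
  with e show "e \<in> (\<lambda>y. {x, y}) ` N x"
    by (auto simp: neighbours_def adjacent_def insert_commute)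
qed (auto simp: neighbours_def adjacent_def)

lemma vertex_degree_eq: "vertex_degree E x = card (N x)"
proof -
  have "inj_on (\<lambda>y. {x, y}) (N x)" by (auto simp: inj_on_def doubleton_eq_iff)
  then show ?thesis by (simp add: vertex_degree_def incident_edges_eq card_image)
qed

text \<open>Excludes the unspecified \<open>pmf_of_set {}\<close>: some edge supplies a second
  vertex, and a path to it must leave \<open>x\<close>.\<close>

lemma neighbours_nonempty:
  assumes "x \<in> V" shows "N x \<noteq> {}"
proof -
  obtain e where e: "e \<in> E" using edges by blast
  then have "card e = 2" "e \<subseteq> V" using simple by (auto simp: simple_graph_def)
  then obtain y where y: "y \<in> V" "y \<noteq> x"
    by (metis card_2_iff insert_subset)
  then have "(adjacent E)\<^sup>*\<^sup>* x y" using assms connected by (auto simp: connected_graph_def)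
  then show ?thesis using y by (cases rule: converse_rtranclpE) (auto simp: neighbours_def)
qed

lemma deg_pos: "x \<in> V \<Longrightarrow> deg x > 0"
  using neighbours_nonempty finite_neighbours by (simp add: card_gt_0_iff)

lemma sum_deg: "(\<Sum>x\<in>V. deg x) = 2 * real (card E)"
proof -
  have "(\<Sum>x\<in>V. card {e \<in> E. x \<in> e}) = 2 * card E"
  proof (rule sum_multicount[OF finite_V finite_E, rule_format])
    fix e assume "e \<in> E"
    then have "{x \<in> V. x \<in> e} = e" "card e = 2" using simple by (auto simp: simple_graph_def)
    then show "card {x \<in> V. x \<in> e} = 2" by simp
  qed
  then show ?thesis
    by (simp add: vertex_degree_eq[symmetric] vertex_degree_def flip: of_nat_sum)
qed

text \<open>By symmetry of adjacency, \<open>y\<close> is counted once per neighbour. In other words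
  the degrees are an invariant measure of the walk; the bound on truncated means and Kac's formula
  both rest on this.\<close>

lemma sum_neighbours: "(\<Sum>x\<in>V. \<Sum>y\<in>N x. f y) = (\<Sum>y\<in>V. deg y * f y)" for f :: "'a \<Rightarrow> real"
proof -
  have 1: "(\<Sum>y\<in>N x. f y) = (\<Sum>y\<in>V. if y \<in> N x then f y else 0)" for x
    using neighbours_subset[of x] finite_V by (simp add: sum.inter_restrict[symmetric] Int_absorb1)
  have 2: "(\<Sum>x\<in>V. if y \<in> N x then f y else 0) = deg y * f y" for y
  proof -
    have "(\<Sum>x\<in>V. if y \<in> N x then f y else 0) = (\<Sum>x\<in>V. if x \<in> N y then f y else 0)"
      by (simp add: neighbours_sym[of y])
    also have "\<dots> = (\<Sum>x\<in>N y. f y)"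
      using neighbours_subset[of y] finite_V
      by (simp add: sum.inter_restrict[symmetric] Int_absorb1)
    finally show ?thesis by simp
  qed
  show ?thesis unfolding 1 by (subst sum.swap) (simp add: 2)
qed

section \<open>Induction along edges and the maximum principle\<close>

lemma connected_induct:
  assumes "x \<in> V" "y \<in> V" "P x" and step: "\<And>u w. u \<in> V \<Longrightarrow> P u \<Longrightarrow> w \<in> N u \<Longrightarrow> P w"
  shows "P y"
proof -
  have "(adjacent E)\<^sup>*\<^sup>* x y" using assms(1,2) connected by (auto simp: connected_graph_def)
  then have "y \<in> V \<and> P y"
  proof (induction rule: rtranclp_induct)
    case (step u w)
    then have "w \<in> N u" by (simp add: neighbours_def)
    then show ?case using step assms(4)[of u w] neighbours_subset by blast
  qed (use assms(1,3) in auto)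
  then show ?thesis by simp
qed

text \<open>Maximum principle: a maximum attained off \<open>j\<close> spreads to all neighbours,
  hence along a path to \<open>j\<close>, where the value is 0.\<close>

lemma harmonic_le_0:
  fixes f :: "'a \<Rightarrow> real"
  assumes j: "j \<in> V" "f j = 0"
    and harm: "\<And>x. x \<in> V \<Longrightarrow> x \<noteq> j \<Longrightarrow> deg x * f x = (\<Sum>y\<in>N x. f y)"
    and x: "x \<in> V"
  shows "f x \<le> 0"
proof -
  define M where "M = Max (f ` V)"
  have le: "f y \<le> M" if "y \<in> V" for y using that finite_V by (simp add: M_def)
  have "M \<in> f ` V" unfolding M_def using finite_V j by (intro Max_in) auto
  then obtain z where z: "z \<in> V" "f z = M" by auto
  \<comment> \<open>The disjunct \<open>f j = M\<close> in the induction predicate covers paths that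
    pass through \<open>j\<close>, where \<open>f\<close> need not be harmonic. The repetition is
    its instance at \<open>j\<close>.\<close>
  have "f j = M \<or> f j = M"
  proof (rule connected_induct[OF z(1) j(1), where P = "\<lambda>u. f j = M \<or> f u = M"])
    fix u w assume u: "u \<in> V" "f j = M \<or> f u = M" and w: "w \<in> N u"
    show "f j = M \<or> f w = M"
    proof (cases "f j = M")
      case False
      with u have uM: "f u = M" "u \<noteq> j" by auto
      \<comment> \<open>All summands are nonnegative, so each of them vanishes.\<close>
      have "(\<Sum>y\<in>N u. M - f y) = 0"
        using harm[OF u(1) uM(2)] uM by (simp add: sum_subtractf)
      then have "M - f w = 0"
        using w le neighbours_subset finite_neighbours
        by (subst (asm) sum_nonneg_eq_0_iff) (auto simp: subset_iff)
      then show ?thesis by simp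
    qed simp
  qed (use z in auto)
  then show ?thesis using le[OF x] j by simp
qed

text \<open>The Dirichlet problem with source \<open>r\<close> and boundary point \<open>j\<close>
  has at most one solution. Identities about hitting times are proved below by checking that both
  sides solve the same problem.\<close>

lemma harmonic_unique:
  fixes f g :: "'a \<Rightarrow> real"
  assumes j: "j \<in> V" "f j = g j"
    and f: "\<And>x. x \<in> V \<Longrightarrow> x \<noteq> j \<Longrightarrow> deg x * f x = r x + (\<Sum>y\<in>N x. f y)"
    and g: "\<And>x. x \<in> V \<Longrightarrow> x \<noteq> j \<Longrightarrow> deg x * g x = r x + (\<Sum>y\<in>N x. g y)"
    and x: "x \<in> V"
  shows "f x = g x"
proof (rule antisym)
  have "f x - g x \<le> 0"
    by (rule harmonic_le_0[of j "\<lambda>x. f x - g x"])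
      (use j f g x in \<open>auto simp: right_diff_distrib sum_subtractf\<close>)
  then show "f x \<le> g x" by simp
  have "g x - f x \<le> 0"
    by (rule harmonic_le_0[of j "\<lambda>x. g x - f x"])
      (use j f g x in \<open>auto simp: right_diff_distrib sum_subtractf\<close>)
  then show "g x \<le> f x" by simp
qed

section \<open>Convergence of the hitting time series\<close>

lemma first_hit_prob_step:
  assumes "x \<in> V" "x \<noteq> j"
  shows "deg x * first_hit_prob E x j (Suc n) = (\<Sum>k\<in>N x. first_hit_prob E k j n)"
  using first_hit_prob_Suc[OF finite_neighbours neighbours_nonempty, of x j n] assms deg_pos[of x]
  by simp

lemma first_hit_prob_self: "j \<in> V \<Longrightarrow> first_hit_prob E j j (Suc n) = 0"
  using first_hit_prob_Suc[OF finite_neighbours neighbours_nonempty, of j j n] by simp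

text \<open>The summands are taken in trajectory laws of different lengths, so instead of
  disjointness of events the first-step recursion is used, by induction on the horizon.\<close>

lemma sum_first_hit_prob_le_1:
  assumes "x \<in> V" "j \<in> V"
  shows "(\<Sum>n\<le>m. first_hit_prob E x j n) \<le> 1"
  using assms(1)
proof (induction m arbitrary: x)
  case 0
  then show ?case by (simp add: first_hit_prob_0)
next
  case (Suc m)
  show ?case
  proof (cases "x = j")
    case True
    then show ?thesis
      using assms(2) by (simp only: sum.atMost_Suc_shift)
        (simp add: first_hit_prob_0 first_hit_prob_self)
  next
    case False
    have "deg x * (\<Sum>n\<le>Suc m. first_hit_prob E x j n)
        = (\<Sum>n\<le>m. deg x * first_hit_prob E x j (Suc n))"
      using False by (simp only: sum.atMost_Suc_shift) (simp add: first_hit_prob_0 sum_distrib_left)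
    also have "\<dots> = (\<Sum>k\<in>N x. \<Sum>n\<le>m. first_hit_prob E k j n)"
      using Suc.prems False by (simp add: first_hit_prob_step) (rule sum.swap)
    also have "\<dots> \<le> (\<Sum>k\<in>N x. 1)"
      using Suc.IH neighbours_subset by (intro sum_mono) auto
    finally have "deg x * (\<Sum>n\<le>Suc m. first_hit_prob E x j n) \<le> deg x * 1" by simp
    then show ?thesis using deg_pos[OF Suc.prems] by (simp only: mult_le_cancel_left_pos)
  qed
qed

definition partial_hit :: "'a \<Rightarrow> nat \<Rightarrow> 'a \<Rightarrow> real" where
  "partial_hit j m x = (\<Sum>n\<le>m. real n * first_hit_prob E x j n)"

lemma partial_hit_nonneg: "partial_hit j m x \<ge> 0"
  by (auto simp: partial_hit_def intro!: sum_nonneg mult_nonneg_nonneg first_hit_prob_nonneg)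

lemma partial_hit_mono: "partial_hit j m x \<le> partial_hit j (Suc m) x"
  by (simp add: partial_hit_def first_hit_prob_nonneg)

lemma partial_hit_self: "j \<in> V \<Longrightarrow> partial_hit j m j = 0"
  by (induction m) (simp_all add: partial_hit_def first_hit_prob_self)

text \<open>Truncated first-step equation: after the index shift, \<open>Suc n = 1 + n\<close>
  splits off the probability of a hit within \<open>m\<close> steps.\<close>

lemma partial_hit_Suc:
  assumes "x \<in> V" "x \<noteq> j"
  shows "deg x * partial_hit j (Suc m) x =
    (\<Sum>k\<in>N x. \<Sum>n\<le>m. first_hit_prob E k j n) + (\<Sum>k\<in>N x. partial_hit j m k)"
proof -
  have "deg x * partial_hit j (Suc m) x
      = (\<Sum>n\<le>m. real (Suc n) * (deg x * first_hit_prob E x j (Suc n)))"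
    unfolding partial_hit_def
    by (simp only: sum.atMost_Suc_shift sum_distrib_left) (simp add: algebra_simps sum_distrib_left)
  also have "\<dots> = (\<Sum>n\<le>m. \<Sum>k\<in>N x. real (Suc n) * first_hit_prob E k j n)"
    using assms by (simp add: first_hit_prob_step sum_distrib_left)
  also have "\<dots> = (\<Sum>k\<in>N x. \<Sum>n\<le>m. real (Suc n) * first_hit_prob E k j n)"
    by (rule sum.swap)
  finally show ?thesis
    by (simp add: partial_hit_def sum.distrib distrib_right)
qed

text \<open>Summing the recursion against the degrees, monotonicity in time leaves room for at most
  twice the number of edges at the neighbours of the target.\<close>

lemma partial_hit_neighbour_le:
  assumes j: "j \<in> V" and k: "k \<in> N j"
  shows "partial_hit j m k \<le> 2 * real (card E)"
proof -
  let ?s = "\<lambda>x. \<Sum>y\<in>N x. partial_hit j m y"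
  have "(\<Sum>x\<in>V. deg x * partial_hit j m x) \<le> (\<Sum>x\<in>V. deg x * partial_hit j (Suc m) x)"
    by (intro sum_mono mult_left_mono partial_hit_mono) auto
  also have "\<dots> = (\<Sum>x\<in>V - {j}. deg x * partial_hit j (Suc m) x)"
    using j finite_V by (intro sum.mono_neutral_right) (auto simp: partial_hit_self)
  also have "\<dots> \<le> (\<Sum>x\<in>V - {j}. deg x + ?s x)"
  proof (rule sum_mono)
    fix x assume x: "x \<in> V - {j}"
    have "(\<Sum>k\<in>N x. \<Sum>n\<le>m. first_hit_prob E k j n) \<le> (\<Sum>k\<in>N x. 1)"
      using sum_first_hit_prob_le_1[OF _ j] neighbours_subset by (intro sum_mono) auto
    then show "deg x * partial_hit j (Suc m) x \<le> deg x + ?s x"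
      using x by (simp add: partial_hit_Suc)
  qed
  also have "\<dots> = 2 * real (card E) - deg j + (\<Sum>x\<in>V. deg x * partial_hit j m x) - ?s j"
    using j finite_V by (simp add: sum.distrib sum_diff1 sum_deg sum_neighbours)
  finally have "?s j \<le> 2 * real (card E)" by simp
  moreover have "partial_hit j m k \<le> ?s j"
    using k finite_neighbours by (intro member_le_sum partial_hit_nonneg) auto
  ultimately show ?thesis by simp
qed

text \<open>The bound travels along edges from \<open>j\<close>. Away from \<open>j\<close>, the
  recursion bounds the values at the neighbours by the value at \<open>u\<close> one step later,
  which is harmless as \<open>B\<close> is uniform in \<open>m\<close>. At \<open>j\<close> the
  recursion fails and \<open>partial_hit_neighbour_le\<close> takes over.\<close>

lemma partial_hit_bounded:
  assumes "j \<in> V" "x \<in> V"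
  shows "\<exists>B. \<forall>m. partial_hit j m x \<le> B"
proof (rule connected_induct[OF assms])
  show "\<exists>B. \<forall>m. partial_hit j m j \<le> B" using assms by (auto simp: partial_hit_self)
next
  fix u w assume u: "u \<in> V" "\<exists>B. \<forall>m. partial_hit j m u \<le> B" and w: "w \<in> N u"
  show "\<exists>B. \<forall>m. partial_hit j m w \<le> B"
  proof (cases "u = j")
    case True
    then show ?thesis using partial_hit_neighbour_le[OF assms(1)] w by blast
  next
    case False
    obtain B where B: "partial_hit j m u \<le> B" for m using u by auto
    have "partial_hit j m w \<le> deg u * B" for m
    proof -
      have "partial_hit j m w \<le> (\<Sum>k\<in>N u. partial_hit j m k)"
        using w finite_neighbours by (intro member_le_sum partial_hit_nonneg) auto
      also have "\<dots> \<le> deg u * partial_hit j (Suc m) u"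
        using u False by (simp add: partial_hit_Suc sum_nonneg first_hit_prob_nonneg)
      also have "\<dots> \<le> deg u * B" by (intro mult_left_mono B) auto
      finally show ?thesis .
    qed
    then show ?thesis by blast
  qed
qed

lemma summable_hit:
  assumes "j \<in> V" "x \<in> V"
  shows "summable (\<lambda>n. real n * first_hit_prob E x j n)"
proof -
  obtain B where B: "partial_hit j m x \<le> B" for m using partial_hit_bounded[OF assms] by auto
  show ?thesis
  proof (rule bounded_imp_summable)
    show "(\<Sum>n\<le>m. real n * first_hit_prob E x j n) \<le> B" for m
      using B by (simp add: partial_hit_def)
  qed (simp add: first_hit_prob_nonneg)
qed

lemma summable_first_hit_prob:
  assumes "j \<in> V" "x \<in> V"
  shows "summable (first_hit_prob E x j)"
  by (rule bounded_imp_summable[OF first_hit_prob_nonneg sum_first_hit_prob_le_1]) (use assms in auto)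

text \<open>The hitting probability and the constant 1 are both harmonic off \<open>j\<close> and
  agree at \<open>j\<close>.\<close>

lemma suminf_first_hit_prob:
  assumes j: "j \<in> V" and x: "x \<in> V"
  shows "suminf (first_hit_prob E x j) = 1"
proof (rule harmonic_unique[OF j _ _ _ x, where r = "\<lambda>_. 0" and g = "\<lambda>_. 1"])
  have split: "suminf (first_hit_prob E y j)
      = first_hit_prob E y j 0 + (\<Sum>n. first_hit_prob E y j (Suc n))" if "y \<in> V" for y
    using suminf_split_head[OF summable_first_hit_prob[OF j that]] by simp
  show "suminf (first_hit_prob E j j) = 1"
    using split[OF j] j by (simp add: first_hit_prob_0 first_hit_prob_self)
  fix y assume y: "y \<in> V" "y \<noteq> j"
  have "deg y * suminf (first_hit_prob E y j) = (\<Sum>n. deg y * first_hit_prob E y j (Suc n))"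
    using y summable_first_hit_prob[OF j y(1)]
    by (simp add: split first_hit_prob_0 suminf_mult summable_Suc_iff)
  also have "\<dots> = (\<Sum>n. \<Sum>k\<in>N y. first_hit_prob E k j n)"
    using y by (simp add: first_hit_prob_step)
  also have "\<dots> = (\<Sum>k\<in>N y. suminf (first_hit_prob E k j))"
    using summable_first_hit_prob[OF j] neighbours_subset by (intro suminf_sum) auto
  finally show "deg y * suminf (first_hit_prob E y j)
      = 0 + (\<Sum>k\<in>N y. suminf (first_hit_prob E k j))" by simp
qed simp_all

section \<open>Hitting time equations and Kemeny's constant\<close>

lemma hit_self: "j \<in> V \<Longrightarrow> hit j j = 0"
proof -
  assume "j \<in> V"
  then have "(\<lambda>n. real n * first_hit_prob E j j n) = (\<lambda>_. 0)"
    by (intro ext, rename_tac n, case_tac n) (auto simp: first_hit_prob_self)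
  then show ?thesis by (simp add: mean_hitting_time_def)
qed

lemma hit_nonneg: "j \<in> V \<Longrightarrow> x \<in> V \<Longrightarrow> hit x j \<ge> 0"
  unfolding mean_hitting_time_def
  by (intro suminf_nonneg summable_hit) (auto simp: first_hit_prob_nonneg)

text \<open>First-step analysis: the term at \<open>n = 0\<close> vanishes, and after the shift
  \<open>Suc n = 1 + n\<close> splits off the total hitting probability, which is 1.\<close>

lemma hit_step:
  assumes j: "j \<in> V" and x: "x \<in> V" "x \<noteq> j"
  shows "deg x * hit x j = deg x + (\<Sum>k\<in>N x. hit k j)"
proof -
  have "deg x * hit x j = (\<Sum>n. deg x * (real (Suc n) * first_hit_prob E x j (Suc n)))"
  proof -
    have "hit x j = (\<Sum>n. real (Suc n) * first_hit_prob E x j (Suc n))"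
      using suminf_split_head[OF summable_hit[OF j x(1)]] by (simp add: mean_hitting_time_def)
    moreover have "summable (\<lambda>n. real (Suc n) * first_hit_prob E x j (Suc n))"
      using summable_hit[OF j x(1)] by (subst summable_Suc_iff)
    ultimately show ?thesis by (simp only: suminf_mult)
  qed
  also have "\<dots> = (\<Sum>n. \<Sum>k\<in>N x. first_hit_prob E k j n + real n * first_hit_prob E k j n)"
  proof (rule suminf_cong)
    fix n
    have "deg x * (real (Suc n) * first_hit_prob E x j (Suc n))
        = real (Suc n) * (\<Sum>k\<in>N x. first_hit_prob E k j n)"
      using first_hit_prob_step[OF x, of n] by (simp only: mult.left_commute)
    then show "deg x * (real (Suc n) * first_hit_prob E x j (Suc n))
        = (\<Sum>k\<in>N x. first_hit_prob E k j n + real n * first_hit_prob E k j n)"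
      by (simp add: sum_distrib_left sum.distrib distrib_right)
  qed
  also have "\<dots> = (\<Sum>k\<in>N x. \<Sum>n. first_hit_prob E k j n + real n * first_hit_prob E k j n)"
    using summable_first_hit_prob[OF j] summable_hit[OF j] neighbours_subset
    by (intro suminf_sum summable_add) auto
  also have "\<dots> = (\<Sum>k\<in>N x. 1 + hit k j)"
  proof (rule sum.cong[OF refl])
    fix k assume "k \<in> N x"
    then have k: "k \<in> V" using neighbours_subset by blast
    show "(\<Sum>n. first_hit_prob E k j n + real n * first_hit_prob E k j n) = 1 + hit k j"
      using suminf_add[OF summable_first_hit_prob[OF j k] summable_hit[OF j k]]
      by (simp add: suminf_first_hit_prob[OF j k] mean_hitting_time_def)
  qed
  finally show ?thesis by (simp add: sum.distrib)
qed

text \<open>Kac's formula, multiplied by the degree. Summing \<open>hit_step\<close> over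
  \<open>x \<noteq> j\<close> makes the weighted sums of hitting times cancel by
  \<open>sum_neighbours\<close>.\<close>

lemma return_time:
  assumes j: "j \<in> V"
  shows "deg j + (\<Sum>k\<in>N j. hit k j) = 2 * real (card E)"
proof -
  let ?s = "\<lambda>x. \<Sum>y\<in>N x. hit y j"
  have "(\<Sum>x\<in>V. deg x * hit x j) = (\<Sum>x\<in>V - {j}. deg x * hit x j)"
    using j finite_V by (intro sum.mono_neutral_right) (auto simp: hit_self)
  also have "\<dots> = (\<Sum>x\<in>V - {j}. deg x + ?s x)"
    by (rule sum.cong) (auto simp: hit_step[OF j])
  also have "\<dots> = 2 * real (card E) - deg j + (\<Sum>x\<in>V. deg x * hit x j) - ?s j"
    using j finite_V by (simp add: sum.distrib sum_diff1 sum_deg sum_neighbours)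
  finally show ?thesis by simp
qed

text \<open>As a function of the starting vertex the sum is harmonic, hence constant by the maximum
  principle.\<close>

lemma sum_deg_hit_constant:
  assumes i: "i \<in> V" and x: "x \<in> V"
  shows "(\<Sum>j\<in>V. deg j * hit x j) = (\<Sum>j\<in>V. deg j * hit i j)"
proof (rule harmonic_unique[OF i _ _ _ x, where r = "\<lambda>_. 0" and g = "\<lambda>_. \<Sum>j\<in>V. deg j * hit i j"])
  fix y assume y: "y \<in> V" "y \<noteq> i"
  \<comment> \<open>For \<open>j = y\<close> the first-step equation is replaced by Kac's formula,
    whence the correction. Summed over \<open>j\<close>, the corrections cancel the source terms
    \<open>deg j * deg y\<close>.\<close>
  have eq: "deg y * (deg j * hit y j) = deg j * deg y + (\<Sum>k\<in>N y. deg j * hit k j)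
      - (if j = y then 2 * real (card E) * deg y else 0)" if j: "j \<in> V" for j
  proof (cases "j = y")
    case True
    have "deg y * (deg y + (\<Sum>k\<in>N y. hit k y)) = deg y * (2 * real (card E))"
      by (simp only: return_time[OF y(1)])
    then show ?thesis using True j by (simp add: hit_self sum_distrib_left algebra_simps)
  next
    case False
    then have "deg j * (deg y * hit y j) = deg j * (deg y + (\<Sum>k\<in>N y. hit k j))"
      by (simp add: hit_step[OF j y(1)])
    then show ?thesis using False by (simp add: sum_distrib_left algebra_simps)
  qed
  have "deg y * (\<Sum>j\<in>V. deg j * hit y j) = (\<Sum>j\<in>V. deg j * deg y + (\<Sum>k\<in>N y. deg j * hit k j)
      - (if j = y then 2 * real (card E) * deg y else 0))"
    unfolding sum_distrib_left by (rule sum.cong) (auto simp: eq)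
  also have "\<dots> = (\<Sum>j\<in>V. \<Sum>k\<in>N y. deg j * hit k j)"
    using y finite_V by (simp add: sum.distrib sum_subtractf sum_deg flip: sum_distrib_right)
  also have "\<dots> = (\<Sum>k\<in>N y. \<Sum>j\<in>V. deg j * hit k j)"
    by (rule sum.swap)
  finally show "deg y * (\<Sum>j\<in>V. deg j * hit y j) = 0 + (\<Sum>k\<in>N y. \<Sum>j\<in>V. deg j * hit k j)" by simp
qed simp_all

lemma kemeny_eq:
  assumes i: "i \<in> V"
  shows "kemeny V E = (\<Sum>j\<in>V. deg j * hit i j) / (2 * real (card E))"
proof -
  have "(\<Sum>j\<in>V. stationary E j * hit x j) = (\<Sum>j\<in>V. deg j * hit i j) / (2 * real (card E))"
    if "x \<in> V" for x
    using sum_deg_hit_constant[OF i that]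
    by (simp add: stationary_def vertex_degree_eq flip: sum_divide_distrib)
  then show ?thesis unfolding kemeny_def using i by (intro the_equality) auto
qed

lemma hit_ge_1:
  assumes "j \<in> V" "x \<in> V" "x \<noteq> j"
  shows "hit x j \<ge> 1"
proof -
  have "deg x * 1 \<le> deg x * hit x j"
    using hit_step[OF assms] hit_nonneg[OF assms(1)] neighbours_subset
    by (simp add: sum_nonneg subset_iff)
  then show ?thesis using deg_pos[OF assms(2)] by (simp only: mult_le_cancel_left_pos)
qed

lemma deg_le_card_edges: "deg x \<le> real (card E)"
  unfolding vertex_degree_eq[symmetric] vertex_degree_def using finite_E by (simp add: card_mono)

text \<open>For \<open>v \<in> V\<close> this is \<open>2 * card E\<close> times Kemeny's constant,
  by \<open>kemeny_eq\<close>; \<open>hit_to v\<close> is likewise the unnormalised mean hitting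
  time of \<open>v\<close> from a stationary start.\<close>

definition hit_from :: "'a \<Rightarrow> real" where
  "hit_from v = (\<Sum>j\<in>V. deg j * hit v j)"

definition hit_to :: "'a \<Rightarrow> real" where
  "hit_to v = (\<Sum>j\<in>V. deg j * hit j v)"

text \<open>Hitting times from other vertices are at least 1, and their degrees sum to
  \<open>2 * card E - deg v\<close>, where \<open>deg v\<close> is at most
  \<open>card E\<close>.\<close>

lemma hit_to_ge:
  assumes v: "v \<in> V"
  shows "hit_to v \<ge> real (card E)"
proof -
  have "real (card E) \<le> (\<Sum>j\<in>V - {v}. deg j)"
    using v finite_V deg_le_card_edges[of v] by (simp add: sum_diff1 sum_deg)
  also have "\<dots> \<le> (\<Sum>j\<in>V - {v}. deg j * hit j v)"
    by (rule sum_mono) (use mult_left_mono[OF hit_ge_1[OF v]] in force)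
  also have "\<dots> = (\<Sum>j\<in>V. deg j * hit j v)"
    using v finite_V by (intro sum.mono_neutral_left) (auto simp: hit_self)
  finally show ?thesis unfolding hit_to_def .
qed

end

section \<open>Gluing two graphs at a vertex\<close>

lemma neighbours_Un: "neighbours (E \<union> F) x = neighbours E x \<union> neighbours F x"
  by (auto simp: neighbours_def adjacent_def)

lemma (in walk_graph) neighbours_outside: "x \<notin> V \<Longrightarrow> N x = {}"
  by (auto simp: neighbours_def adjacent_def dest: edge_endpoints)

locale glued_graphs = G: walk_graph V E + H: walk_graph W F
  for V :: "'a set" and E and W :: "'a set" and F +
  fixes v :: 'a
  assumes inter: "V \<inter> W = {v}"
begin

lemma v_in: "v \<in> V" "v \<in> W"
  using inter by auto

lemma disjoint_edges: "E \<inter> F = {}"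
proof (rule equals0I)
  fix e assume "e \<in> E \<inter> F"
  then have "e \<subseteq> V \<inter> W" "card e = 2"
    using G.simple H.simple by (auto simp: simple_graph_def)
  then have "card e \<le> card {v}" unfolding inter by (intro card_mono) auto
  then show False using \<open>card e = 2\<close> by simp
qed

lemma card_glued_edges: "card (E \<union> F) = card E + card F"
  by (rule card_Un_disjoint[OF G.finite_E H.finite_E disjoint_edges])

sublocale U: walk_graph "V \<union> W" "E \<union> F"
proof
  show "simple_graph (V \<union> W) (E \<union> F)"
    using G.simple H.simple by (auto simp: simple_graph_def)
  show "connected_graph (V \<union> W) (E \<union> F)"
  proof (rule connected_graphI[of v])
    fix x assume "x \<in> V \<union> W"
    then have "(adjacent E)\<^sup>*\<^sup>* v x \<or> (adjacent F)\<^sup>*\<^sup>* v x"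
      using G.connected H.connected v_in by (auto simp: connected_graph_def)
    then show "(adjacent (E \<union> F))\<^sup>*\<^sup>* v x" by (auto elim: reachable_mono)
  qed (use v_in in auto)
qed (use G.edges in auto)

lemma disjoint_neighbours: "G.N x \<inter> H.N x = {}"
  using disjoint_edges by (auto simp: neighbours_def adjacent_def)

lemma deg_glued: "U.deg x = G.deg x + H.deg x"
  unfolding neighbours_Un
  by (subst card_Un_disjoint[OF G.finite_neighbours H.finite_neighbours disjoint_neighbours]) simp

lemma sum_neighbours_glued: "(\<Sum>y\<in>U.N x. f y) = (\<Sum>y\<in>G.N x. f y) + (\<Sum>y\<in>H.N x. f y)"
  for f :: "'a \<Rightarrow> real"
  unfolding neighbours_Un
  by (rule sum.union_disjoint[OF G.finite_neighbours H.finite_neighbours disjoint_neighbours])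

text \<open>A walk from \<open>W\<close> to \<open>j\<close> must pass \<open>v\<close>. On
  \<open>W\<close> off \<open>v\<close> degrees and neighbours are those of \<open>F\<close>, so
  both sides solve the same equations there.\<close>

lemma hit_glued_through:
  assumes j: "j \<in> V" and x: "x \<in> W"
  shows "U.hit x j = H.hit x v + U.hit v j"
proof (rule H.harmonic_unique[OF v_in(2) _ _ _ x, where r = H.deg])
  fix y assume y: "y \<in> W" "y \<noteq> v"
  then have yV: "y \<notin> V" using inter by auto
  then have "y \<noteq> j" using j by auto
  then show "H.deg y * U.hit y j = H.deg y + (\<Sum>k\<in>H.N y. U.hit k j)"
    using U.hit_step[of j y] j y G.neighbours_outside[OF yV]
    by (simp add: deg_glued sum_neighbours_glued del: of_nat_add)
  show "H.deg y * (H.hit y v + U.hit v j) = H.deg y + (\<Sum>k\<in>H.N y. H.hit k v + U.hit v j)"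
    using H.hit_step[OF v_in(2) y] by (simp add: sum.distrib distrib_left)
qed (simp add: H.hit_self[OF v_in(2)])

text \<open>Each visit to \<open>v\<close> inserts an excursion into \<open>W\<close>, whose mean length is given by the return
  time. The mean number of visits to \<open>v\<close> before \<open>j\<close>, divided by the degree of \<open>v\<close>, is
  \<open>(hit x j + hit j v - hit x v) / (2 * card E)\<close>.\<close>

lemma hit_glued:
  assumes j: "j \<in> V" and x: "x \<in> V"
  shows "U.hit x j
    = G.hit x j + real (card F) / real (card E) * (G.hit x j + G.hit j v - G.hit x v)"
proof (rule G.harmonic_unique[OF j _ _ _ x,
      where r = "\<lambda>x. G.deg x + (if x = v then 2 * real (card F) else 0)"])
  let ?r = "real (card F) / real (card E)"
  show "U.hit j j = G.hit j j + ?r * (G.hit j j + G.hit j v - G.hit j v)"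
    using j by (simp add: G.hit_self U.hit_self)
  fix y assume y: "y \<in> V" "y \<noteq> j"
  note U_step = U.hit_step[of j y, unfolded deg_glued sum_neighbours_glued]
  show "G.deg y * U.hit y j
      = G.deg y + (if y = v then 2 * real (card F) else 0) + (\<Sum>k\<in>G.N y. U.hit k j)"
  proof (cases "y = v")
    case True
    \<comment> \<open>Each edge from \<open>v\<close> into \<open>W\<close> starts an excursion back
      to \<open>v\<close>; Kac's formula in \<open>W\<close> evaluates their total mean length over
      these edges.\<close>
    have "(\<Sum>k\<in>H.N v. U.hit k j) = (\<Sum>k\<in>H.N v. H.hit k v + U.hit v j)"
      by (rule sum.cong) (use hit_glued_through[OF j] H.neighbours_subset in auto)
    also have "\<dots> = 2 * real (card F) - H.deg v + H.deg v * U.hit v j"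
      using H.return_time[OF v_in(2)] by (simp add: sum.distrib)
    finally show ?thesis using U_step y j True by (simp add: distrib_right)
  next
    case False
    then have "H.N y = {}" using y inter by (intro H.neighbours_outside) auto
    then show ?thesis using U_step y j False by simp
  qed
  have j_step: "G.deg y * G.hit y j = G.deg y + (\<Sum>k\<in>G.N y. G.hit k j)"
    by (rule G.hit_step[OF j y])
  \<comment> \<open>At \<open>y = v\<close> the left side is 0, and Kac's formula gives the defect
    \<open>2 * card E\<close>, which the factor \<open>?r\<close> turns into the source
    \<open>2 * card F\<close>.\<close>
  have v_step: "G.deg y * G.hit y v
      = G.deg y + (\<Sum>k\<in>G.N y. G.hit k v) - (if y = v then 2 * real (card E) else 0)"
    using G.hit_step[OF v_in(1) y(1)] G.return_time[OF v_in(1)] G.hit_self[OF v_in(1)] by auto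
  have "G.deg y * (G.hit y j + ?r * (G.hit y j + G.hit j v - G.hit y v))
      = G.deg y * G.hit y j
        + ?r * (G.deg y * G.hit y j + G.deg y * G.hit j v - G.deg y * G.hit y v)"
    by (simp add: algebra_simps)
  also have "\<dots> = G.deg y + (\<Sum>k\<in>G.N y. G.hit k j)
      + ?r * ((\<Sum>k\<in>G.N y. G.hit k j) + G.deg y * G.hit j v - (\<Sum>k\<in>G.N y. G.hit k v)
        + (if y = v then 2 * real (card E) else 0))"
    unfolding j_step v_step by (simp add: algebra_simps)
  also have "\<dots> = G.deg y + (if y = v then 2 * real (card F) else 0)
      + (\<Sum>k\<in>G.N y. G.hit k j + ?r * (G.hit k j + G.hit j v - G.hit k v))"
    using G.card_edges_pos
    by (simp add: sum.distrib sum_subtractf distrib_left flip: sum_distrib_left sum_divide_distrib)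
  finally show "G.deg y * (G.hit y j + ?r * (G.hit y j + G.hit j v - G.hit y v))
      = G.deg y + (if y = v then 2 * real (card F) else 0)
      + (\<Sum>k\<in>G.N y. G.hit k j + ?r * (G.hit k j + G.hit j v - G.hit k v))" .
qed

lemma sum_deg_hit_glued:
  "(\<Sum>j\<in>V \<union> W. G.deg j * U.hit v j)
    = G.hit_from v + real (card F) / real (card E) * (G.hit_from v + G.hit_to v)"
proof -
  have "(\<Sum>j\<in>V \<union> W. G.deg j * U.hit v j) = (\<Sum>j\<in>V. G.deg j * U.hit v j)"
    using U.finite_V by (intro sum.mono_neutral_right) (auto simp: G.neighbours_outside)
  also have "\<dots> = (\<Sum>j\<in>V. G.deg j * G.hit v j
      + real (card F) / real (card E) * (G.deg j * G.hit v j + G.deg j * G.hit j v))"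
    by (rule sum.cong) (use v_in in \<open>auto simp: hit_glued G.hit_self algebra_simps\<close>)
  also have "\<dots> = G.hit_from v + real (card F) / real (card E) * (G.hit_from v + G.hit_to v)"
    by (simp add: G.hit_from_def G.hit_to_def sum.distrib
      flip: sum_distrib_left sum_divide_distrib)
  finally show ?thesis .
qed

end

lemma (in glued_graphs) kemeny_glued:
  "2 * (real (card E) + real (card F)) * kemeny (V \<union> W) (E \<union> F)
    = G.hit_from v + real (card F) / real (card E) * (G.hit_from v + G.hit_to v)
    + (H.hit_from v + real (card E) / real (card F) * (H.hit_from v + H.hit_to v))"
proof -
  \<comment> \<open>Degrees in the union split into a \<open>G\<close> part and an \<open>H\<close>
    part; exchanging the roles of the two graphs handles the second.\<close>
  interpret swapped: glued_graphs W F V E v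
    by unfold_locales (use inter in auto)
  have "2 * (real (card E) + real (card F)) * kemeny (V \<union> W) (E \<union> F)
      = (\<Sum>j\<in>V \<union> W. U.deg j * U.hit v j)"
    using U.kemeny_eq[of v] v_in G.card_edges_pos by (simp add: card_glued_edges)
  also have "\<dots> = (\<Sum>j\<in>V \<union> W. G.deg j * U.hit v j) + (\<Sum>j\<in>W \<union> V. H.deg j * swapped.U.hit v j)"
    by (simp add: deg_glued distrib_right sum.distrib Un_commute)
  finally show ?thesis
    unfolding sum_deg_hit_glued swapped.sum_deg_hit_glued .
qed

section \<open>The two gadgets and their hitting times\<close>

locale gadget_vertices =
  fixes v a b c :: 'a
  assumes distinct: "v \<noteq> a" "v \<noteq> b" "v \<noteq> c" "a \<noteq> b" "b \<noteq> c" "a \<noteq> c"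
begin

lemmas distinct' = distinct distinct[symmetric]

definition "paw = {{v, a}, {v, b}, {v, c}, {a, b}}"
definition "diamond = {{v, a}, {v, b}, {v, c}, {a, b}, {b, c}}"

lemma card_paw: "card paw = 4"
  using distinct' by (simp add: paw_def doubleton_eq_iff)

lemma card_diamond: "card diamond = 5"
  using distinct' by (simp add: diamond_def doubleton_eq_iff)

lemma star_connected:
  assumes "{{v, a}, {v, b}, {v, c}} \<subseteq> F"
  shows "connected_graph {v, a, b, c} F"
  by (rule connected_graphI[of v]) (use assms in \<open>auto simp: adjacent_def\<close>)

sublocale paw: walk_graph "{v, a, b, c}" paw
proof
  show "simple_graph {v, a, b, c} paw"
    using distinct' by (auto simp: simple_graph_def paw_def)
  show "connected_graph {v, a, b, c} paw" by (rule star_connected) (auto simp: paw_def)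
qed (auto simp: paw_def)

sublocale diamond: walk_graph "{v, a, b, c}" diamond
proof
  show "simple_graph {v, a, b, c} diamond"
    using distinct' by (auto simp: simple_graph_def diamond_def)
  show "connected_graph {v, a, b, c} diamond" by (rule star_connected) (auto simp: diamond_def)
qed (auto simp: diamond_def)

lemma neighbours_paw:
  "neighbours paw v = {a, b, c}" "neighbours paw a = {v, b}" "neighbours paw b = {v, a}"
  "neighbours paw c = {v}"
  using distinct' by (auto simp: neighbours_def adjacent_def paw_def doubleton_eq_iff)

lemma neighbours_diamond:
  "neighbours diamond v = {a, b, c}" "neighbours diamond a = {v, b}"
  "neighbours diamond b = {v, a, c}" "neighbours diamond c = {v, b}"
  using distinct' by (auto simp: neighbours_def adjacent_def diamond_def doubleton_eq_iff)

text \<open>For each target, the first-step equations at the other three vertices form a linear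
  system. The solutions are weighted by the degrees 3, 2, 2, 1 of \<open>v\<close>,
  \<open>a\<close>, \<open>b\<close>, \<open>c\<close>.\<close>

lemma paw_hit:
  "paw.hit_to v = 9" "paw.hit_from v = 61 / 3"
proof -
  have step: "paw.deg x * paw.hit x j = paw.deg x + (\<Sum>k\<in>paw.N x. paw.hit k j)"
    if "j \<in> {v, a, b, c}" "x \<in> {v, a, b, c}" "x \<noteq> j" for x j
    using paw.hit_step that by blast
  note simps = neighbours_paw distinct' paw.hit_self
  have "paw.hit a v = 2" "paw.hit b v = 2" "paw.hit c v = 1"
    using step[of v a] step[of v b] step[of v c] by (simp_all add: simps)
  then show "paw.hit_to v = 9"
    unfolding paw.hit_to_def by (simp add: simps)
  have "paw.hit v a = 10 / 3"
    using step[of a v] step[of a b] step[of a c] by (simp add: simps)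
  moreover have "paw.hit v b = 10 / 3"
    using step[of b v] step[of b a] step[of b c] by (simp add: simps)
  moreover have "paw.hit v c = 7"
    using step[of c v] step[of c a] step[of c b] by (simp add: simps)
  ultimately show "paw.hit_from v = 61 / 3"
    unfolding paw.hit_from_def by (simp add: simps)
qed

text \<open>As for the paw, with degrees 3, 2, 3, 2; the symmetry between \<open>a\<close> and
  \<open>c\<close> shows in the equal values.\<close>

lemma diamond_hit:
  "diamond.hit_to v = 33 / 2" "diamond.hit_from v = 47 / 2"
proof -
  have step: "diamond.deg x * diamond.hit x j = diamond.deg x + (\<Sum>k\<in>diamond.N x. diamond.hit k j)"
    if "j \<in> {v, a, b, c}" "x \<in> {v, a, b, c}" "x \<noteq> j" for x j
    using diamond.hit_step that by blast
  note simps = neighbours_diamond distinct' diamond.hit_self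
  have "diamond.hit a v = 9 / 4" "diamond.hit b v = 5 / 2" "diamond.hit c v = 9 / 4"
    using step[of v a] step[of v b] step[of v c] by (simp_all add: simps)
  then show "diamond.hit_to v = 33 / 2"
    unfolding diamond.hit_to_def by (simp add: simps)
  have "diamond.hit v a = 4"
    using step[of a v] step[of a b] step[of a c] by (simp add: simps)
  moreover have "diamond.hit v b = 5 / 2"
    using step[of b v] step[of b a] step[of b c] by (simp add: simps)
  moreover have "diamond.hit v c = 4"
    using step[of c v] step[of c a] step[of c b] by (simp add: simps)
  ultimately show "diamond.hit_from v = 47 / 2"
    unfolding diamond.hit_from_def by (simp add: simps)
qed

end

section \<open>Comparison of the two Kemeny constants\<close>

theorem theorem4p12:
  fixes V :: "'a set" and E E_bar E_tilde E_hat :: "'a set set" and v a b c :: 'a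
  assumes "simple_graph V E" and "connected_graph V E"
    and "card E \<ge> 4"
    and "v \<in> V"
    and "a \<notin> V" and "b \<notin> V" and "c \<notin> V" and "a \<noteq> b" and "b \<noteq> c" and "a \<noteq> c"
    and "E_bar = E \<union> {{v, a}, {v, b}, {v, c}}"
    and "E_tilde = insert {a, b} E_bar"
    and "E_hat = insert {b, c} (insert {a, b} E_bar)"
  shows "kemeny (V \<union> {a, b, c}) E_hat > kemeny (V \<union> {a, b, c}) E_tilde"
proof -
  interpret G: walk_graph V E
    using assms by unfold_locales auto
  interpret gadget_vertices v a b c
    using assms by unfold_locales auto
  interpret P: glued_graphs V E "{v, a, b, c}" paw v
    using assms by unfold_locales auto
  interpret D: glued_graphs V E "{v, a, b, c}" diamond v
    using assms by unfold_locales auto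
  define m A B where "m = real (card E)" and "A = G.hit_from v" and "B = G.hit_to v"
  have V: "V \<union> {v, a, b, c} = V \<union> {a, b, c}" using assms by auto
  have tilde: "E \<union> paw = E_tilde" and hat: "E \<union> diamond = E_hat"
    using assms by (auto simp: paw_def diamond_def)
  have m: "m \<ge> 4" using assms by (simp add: m_def)
  have B: "B \<ge> m" using G.hit_to_ge assms by (simp add: B_def m_def)
  define K K' where "K = kemeny (V \<union> {a, b, c}) E_tilde" and "K' = kemeny (V \<union> {a, b, c}) E_hat"
  \<comment> \<open>Here \<open>88 / 3 = 61 / 3 + 9\<close>, and \<open>40 = 47 / 2 + 33 / 2\<close>
    in the next equation: the sums of \<open>hit_from\<close> and \<open>hit_to\<close> of the
    gadgets.\<close>
  have K: "2 * (m + 4) * K = A + 4 / m * (A + B) + (61 / 3 + m / 4 * (88 / 3))"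
    using P.kemeny_glued unfolding V tilde card_paw paw_hit K_def A_def B_def m_def by simp
  have K': "2 * (m + 5) * K' = A + 5 / m * (A + B) + (47 / 2 + m / 5 * 40)"
    using D.kemeny_glued unfolding V hat card_diamond diamond_hit K'_def A_def B_def m_def by simp
  \<comment> \<open>\<open>A\<close> has the coefficient \<open>(m + 4) * (m + 5) / m\<close> in
    both products and cancels; \<open>B\<close> is left with
    \<open>(5 * (m + 4) - 4 * (m + 5)) / m = 1\<close>.\<close>
  have "(m + 4) * (2 * (m + 5) * K') - (m + 5) * (2 * (m + 4) * K)
      = B + 2 / 3 * m\<^sup>2 - 3 / 2 * m - 23 / 3"
    unfolding K K' using m by (simp add: field_simps power2_eq_square)
  \<comment> \<open>With \<open>B \<ge> m\<close> and \<open>m * m \<ge> 4 * m\<close> the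
    expression is at least \<open>13 / 6 * m - 23 / 3\<close>, which equals 1 at
    \<open>m = 4\<close>.\<close>
  moreover have "B + 2 / 3 * m\<^sup>2 - 3 / 2 * m - 23 / 3 > 0"
    using B m mult_mono[of 4 m 4 m] mult_right_mono[of 4 m m] unfolding power2_eq_square by linarith
  ultimately have "2 * (m + 4) * (m + 5) * (K' - K) > 0"
    by (simp add: algebra_simps)
  moreover have "2 * (m + 4) * (m + 5) > 0" using m by simp
  ultimately have "K' - K > 0" by (rule zero_less_mult_pos)
  then show ?thesis by (simp add: K_def K'_def)
qed

end
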